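(* Fix an integer $d\geq 5$. For every sufficiently large $n$, there is an $n$-vertex graph $G=(V,E)$ with VC-dimension at most $d$ such that there are no two disjoint subsets $A,B\subset V$ with $|A|,|B|\geq 4n^{4/d}\log n$ for which $(A,B)$ is homogeneous, i.e., for which either $A\times B\subset E$ (every vertex of $A$ adjacent to every vertex of $B$) or no vertex of $A$ is adjacent to any vertex of $B$.
   Context: For a graph $G=(V,E)$ and $v\in V$, $N(v)$ is the set of neighbors of $v$; the VC-dimension of $G$ is the largest $d$ such that some $d$-element $S\subset V$ satisfies: for every $B\subset S$ there is $v\in V$ with $N(v)\cap S=B$. Logarithms are natural. *)

theory Defs
  imports Complex_Main
begin

definition simple_graph :: "'a set \<Rightarrow> ('a \<times> 'a) set \<Rightarrow> bool" where
  "simple_graph V E \<longleftrightarrow> finite V \<and> E \<subseteq> V \<times> V \<and> sym E \<and> irrefl E"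

definition neighbors :: "('a \<times> 'a) set \<Rightarrow> 'a \<Rightarrow> 'a set" where
  "neighbors E v = {w. (v, w) \<in> E}"

definition shattered :: "'a set \<Rightarrow> ('a \<times> 'a) set \<Rightarrow> 'a set \<Rightarrow> bool" where
  "shattered V E S \<longleftrightarrow> S \<subseteq> V \<and> (\<forall>B\<subseteq>S. \<exists>v\<in>V. neighbors E v \<inter> S = B)"

text \<open>Meaningful for finite nonempty V: the empty set is then shattered, so the
  maximum is taken over a finite nonempty set.\<close>

definition vc_dim :: "'a set \<Rightarrow> ('a \<times> 'a) set \<Rightarrow> nat" where
  "vc_dim V E = Max {card S | S. shattered V E S}"

definition homogeneous :: "('a \<times> 'a) set \<Rightarrow> 'a set \<Rightarrow> 'a set \<Rightarrow> bool" where
  "homogeneous E A B \<longleftrightarrow> A \<times> B \<subseteq> E \<or> (A \<times> B) \<inter> E = {}"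

end

theory Submission
  imports Defs
begin

text \<open>
  Take the binomial random graph with edge probability \<open>p = n powr (- 4 / d)\<close>, and put
  \<open>k = d div 2 + 1\<close>, so that \<open>k > d / 2\<close>. The expected number of copies of \<open>K\<^sub>k\<^sub>,\<^sub>k\<close> is at most
  \<open>n powr (2 * k - 4 * k\<^sup>2 / d)\<close>, which tends to 0, and the expected number of empty pairs of size
  \<open>t \<ge> 4 * n powr (4 / d) * ln n\<close> is at most \<open>n ^ (2 * t) * exp (- p * t\<^sup>2) \<le> n powr - 2\<close>.
  Hence some graph has neither. It has no large complete pair, and its VC-dimension is at
  most \<open>d\<close>: in a shattered set \<open>S\<close> with more than \<open>d\<close> elements, any \<open>k\<close> of them have at least
  \<open>2 ^ (card S - k) \<ge> k\<close> common neighbours, one for each trace containing them.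
\<close>

section \<open>Random subsets and the first moment method\<close>

text \<open>Expanding the product of \<open>f i + g i\<close> over \<open>U\<close> gives one term
  per subset \<open>F\<close>. Since \<open>f\<close> vanishes on \<open>Y\<close> and
  \<open>g\<close> on \<open>X\<close>, only the \<open>F\<close> that contain \<open>X\<close> and
  miss \<open>Y\<close> survive. For \<open>p\<close> in the unit interval this is a probability for
  a random subset that keeps each element independently.\<close>

lemma sum_random_subset:
  fixes p :: "'a :: comm_ring_1"
  assumes "finite U" "X \<subseteq> U" "Y \<subseteq> U" "X \<inter> Y = {}"
  shows "(\<Sum>F | F \<subseteq> U \<and> X \<subseteq> F \<and> Y \<inter> F = {}. p ^ card F * (1 - p) ^ card (U - F))
    = p ^ card X * (1 - p) ^ card Y"
proof -
  define f where "f = (\<lambda>i. if i \<in> Y then 0 else p)"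
  define g where "g = (\<lambda>i. if i \<in> X then 0 else 1 - p)"
  \<comment> \<open>The factor is \<open>p\<close> on \<open>X\<close>, \<open>1 - p\<close> on
    \<open>Y\<close> and 1 elsewhere.\<close>
  have "(\<Prod>i\<in>U. f i + g i) = (\<Prod>i\<in>U. (if i \<in> X then p else 1) * (if i \<in> Y then 1 - p else 1))"
    using assms(4) by (intro prod.cong) (auto simp: f_def g_def)
  also have "\<dots> = p ^ card X * (1 - p) ^ card Y"
    using assms by (simp add: prod.distrib flip: prod.inter_restrict) (simp add: Int_absorb1)
  finally have "p ^ card X * (1 - p) ^ card Y = (\<Sum>F\<in>Pow U. prod f F * prod g (U - F))"
    using prod_add[OF \<open>finite U\<close>, of f g] by simp
  also have "\<dots> = (\<Sum>F | F \<subseteq> U \<and> X \<subseteq> F \<and> Y \<inter> F = {}. prod f F * prod g (U - F))"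
  proof (rule sum.mono_neutral_right)
    show "\<forall>F\<in>Pow U - {F. F \<subseteq> U \<and> X \<subseteq> F \<and> Y \<inter> F = {}}. prod f F * prod g (U - F) = 0"
    proof
      fix F assume F: "F \<in> Pow U - {F. F \<subseteq> U \<and> X \<subseteq> F \<and> Y \<inter> F = {}}"
      then have fin: "finite F" "finite (U - F)"
        using \<open>finite U\<close> finite_subset by auto
      from F consider i where "i \<in> X" "i \<notin> F" | i where "i \<in> Y" "i \<in> F" by blast
      then show "prod f F * prod g (U - F) = 0"
      proof cases
        case 1
        then have "prod g (U - F) = 0"
          using fin \<open>X \<subseteq> U\<close> by (intro prod_zero) (auto simp: g_def)
        then show ?thesis by simp
      next
        case 2
        then have "prod f F = 0"
          using fin by (intro prod_zero) (auto simp: f_def)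
        then show ?thesis by simp
      qed
    qed
  qed (use \<open>finite U\<close> in auto)
  also have "\<dots> = (\<Sum>F | F \<subseteq> U \<and> X \<subseteq> F \<and> Y \<inter> F = {}. p ^ card F * (1 - p) ^ card (U - F))"
  proof (intro sum.cong refl)
    fix F assume F: "F \<in> {F. F \<subseteq> U \<and> X \<subseteq> F \<and> Y \<inter> F = {}}"
    have "prod f F = (\<Prod>i\<in>F. p)" "prod g (U - F) = (\<Prod>i\<in>U - F. 1 - p)"
      using F by (intro prod.cong; auto simp: f_def g_def)+
    then show "prod f F * prod g (U - F) = p ^ card F * (1 - p) ^ card (U - F)"
      by simp
  qed
  finally show ?thesis by simp
qed

text \<open>First moment method: \<open>less\<close> bounds the expectation of the count
  \<open>R\<close> of bad events. Some \<open>F\<close> then has \<open>R F < 1\<close>, and a count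
  below 1 is 0.\<close>

lemma random_subset_union_bound:
  fixes p :: real
  assumes "finite U" "0 \<le> p" "p \<le> 1"
    and P: "P \<subseteq> Pow U" "\<And>X. X \<in> P \<Longrightarrow> card X = a"
    and Q: "Q \<subseteq> Pow U" "\<And>Y. Y \<in> Q \<Longrightarrow> card Y = b"
    and less: "card P * p ^ a + card Q * (1 - p) ^ b < 1"
  obtains F where "F \<subseteq> U" "\<And>X. X \<in> P \<Longrightarrow> \<not> X \<subseteq> F" "\<And>Y. Y \<in> Q \<Longrightarrow> Y \<inter> F \<noteq> {}"
proof -
  define w where "w = (\<lambda>F. p ^ card F * (1 - p) ^ card (U - F))"
  have w0: "w F \<ge> 0" for F
    using assms by (simp add: w_def)
  have fin: "finite P" "finite Q" "finite (Pow U)"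
    using P Q \<open>finite U\<close> finite_subset[OF _ finite_Pow_iff[THEN iffD2]] by auto
  define R where "R = (\<lambda>F. real (card {X \<in> P. X \<subseteq> F}) + card {Y \<in> Q. Y \<inter> F = {}})"
  have "\<exists>F\<in>Pow U. R F < 1"
  proof (rule ccontr)
    assume "\<not> ?thesis"
    then have R: "R F \<ge> 1" if "F \<subseteq> U" for F
      using that by (meson PowI not_le)
    have "1 = (\<Sum>F\<in>Pow U. w F)"
      using sum_random_subset[OF \<open>finite U\<close>, of "{}" "{}" p] by (simp add: w_def Pow_def)
    also have "\<dots> \<le> (\<Sum>F\<in>Pow U. w F * R F)"
      using mult_left_mono[OF R w0] by (intro sum_mono) force
    also have "\<dots> = (\<Sum>F\<in>Pow U. \<Sum>X\<in>P. if X \<subseteq> F then w F else 0)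
        + (\<Sum>F\<in>Pow U. \<Sum>Y\<in>Q. if Y \<inter> F = {} then w F else 0)"
      using fin by (simp add: R_def algebra_simps sum.distrib flip: sum.inter_filter)
    \<comment> \<open>Linearity of expectation: each inner sum is now the probability of a single
      bad event.\<close>
    also have "\<dots> = (\<Sum>X\<in>P. \<Sum>F\<in>Pow U. if X \<subseteq> F then w F else 0)
        + (\<Sum>Y\<in>Q. \<Sum>F\<in>Pow U. if Y \<inter> F = {} then w F else 0)"
      by (subst (1 2) sum.swap) simp
    also have "\<dots> = (\<Sum>X\<in>P. p ^ a) + (\<Sum>Y\<in>Q. (1 - p) ^ b)"
    proof (intro arg_cong2[where f = "(+)"] sum.cong refl)
      fix X assume "X \<in> P"
      then show "(\<Sum>F\<in>Pow U. if X \<subseteq> F then w F else 0) = p ^ a"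
        using sum_random_subset[OF \<open>finite U\<close>, of X "{}" p] P fin
        by (auto simp: w_def simp flip: sum.inter_filter)
    next
      fix Y assume "Y \<in> Q"
      then show "(\<Sum>F\<in>Pow U. if Y \<inter> F = {} then w F else 0) = (1 - p) ^ b"
        using sum_random_subset[OF \<open>finite U\<close>, of "{}" Y p] Q fin
        by (auto simp: w_def simp flip: sum.inter_filter)
    qed
    finally show False
      using less by simp
  qed
  then obtain F where F: "F \<subseteq> U" "R F < 1" by blast
  then have "card {X \<in> P. X \<subseteq> F} = 0" "card {Y \<in> Q. Y \<inter> F = {}} = 0"
    by (auto simp: R_def)
  then have "{X \<in> P. X \<subseteq> F} = {}" "{Y \<in> Q. Y \<inter> F = {}} = {}"
    using fin by simp_all
  with F that show thesis by blast
qed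

section \<open>The random graph\<close>

text \<open>The union bound is applied to random sets of increasing pairs, so that each potential
  edge is chosen once; the graph is the symmetric closure of the chosen set.\<close>

lemma ex_graph_without_biclique_or_empty_pair:
  fixes p :: real
  assumes p: "0 \<le> p" "p \<le> 1"
    and less: "real n ^ (2 * k) * p ^ k\<^sup>2 + real n ^ (2 * t) * (1 - p) ^ t\<^sup>2 < 1"
  obtains E where "simple_graph {..<n} E"
    "\<And>A B. A \<subseteq> {..<n} \<Longrightarrow> B \<subseteq> {..<n} \<Longrightarrow> A \<inter> B = {} \<Longrightarrow> card A = k \<Longrightarrow> card B = k
      \<Longrightarrow> \<not> A \<times> B \<subseteq> E"
    "\<And>A B. A \<subseteq> {..<n} \<Longrightarrow> B \<subseteq> {..<n} \<Longrightarrow> A \<inter> B = {} \<Longrightarrow> card A = t \<Longrightarrow> card B = t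
      \<Longrightarrow> A \<times> B \<inter> E \<noteq> {}"
proof -
  define U where "U = {(i, j). i < j \<and> j < n}"
  have "finite U"
    by (rule finite_subset[of _ "{..<n} \<times> {..<n}"]) (auto simp: U_def)
  \<comment> \<open>The potential edges between \<open>A\<close> and \<open>B\<close>, each written
    as an increasing pair.\<close>
  define e where "e = (\<lambda>(A, B). (\<lambda>(a :: nat, b). (min a b, max a b)) ` (A \<times> B))"
  define I where "I = (\<lambda>m. {(A, B). A \<subseteq> {..<n} \<and> B \<subseteq> {..<n} \<and> A \<inter> B = {} \<and> card A = m \<and> card B = m})"
  have subU: "e ` I m \<subseteq> Pow U" for m
    by (force simp: I_def e_def U_def min_def max_def)
  have card_e: "card X = m\<^sup>2" if "X \<in> e ` I m" for X m
  proof -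
    from that obtain A B where AB: "A \<inter> B = {}" "card A = m" "card B = m" "X = e (A, B)"
      by (auto simp: I_def)
    \<comment> \<open>Two distinct pairs with the same sorted form are swaps of each other, which
      would put a vertex into both \<open>A\<close> and \<open>B\<close>.\<close>
    have "inj_on (\<lambda>(a, b). (min a b, max a b)) (A \<times> B)"
      using AB(1) by (auto simp: inj_on_def min_def max_def split: if_splits)
    then show ?thesis
      using AB by (simp add: e_def card_image card_cartesian_product power2_eq_square)
  qed
  have card_I: "card (e ` I m) \<le> real n ^ (2 * m)" for m
  proof -
    let ?S = "{A. A \<subseteq> {..<n} \<and> card A = m}"
    have "finite ?S" by (rule finite_subset[of _ "Pow {..<n}"]) auto
    moreover have "I m \<subseteq> ?S \<times> ?S" by (auto simp: I_def)
    ultimately have "card (e ` I m) \<le> card (?S \<times> ?S)"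
      by (meson card_image_le card_mono finite_SigmaI finite_subset le_trans)
    also have "\<dots> = (n choose m) * (n choose m)"
      by (simp add: card_cartesian_product n_subsets)
    also have "\<dots> \<le> n ^ m * n ^ m"
      by (intro mult_mono) (cases "m \<le> n"; simp add: binomial_le_pow binomial_eq_0)+
    finally show ?thesis
      by (metis mult_2 of_nat_le_iff of_nat_power power_add)
  qed
  have less': "card (e ` I k) * p ^ k\<^sup>2 + card (e ` I t) * (1 - p) ^ t\<^sup>2 < 1"
    using p by (intro le_less_trans[OF _ less] add_mono mult_right_mono card_I) auto
  obtain F where F: "F \<subseteq> U" "\<And>X. X \<in> e ` I k \<Longrightarrow> \<not> X \<subseteq> F"
      "\<And>Y. Y \<in> e ` I t \<Longrightarrow> Y \<inter> F \<noteq> {}"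
    by (rule random_subset_union_bound[OF \<open>finite U\<close> p subU _ subU _ less']) (erule card_e, erule card_e, blast)
  show thesis
  proof
    show "simple_graph {..<n} (F \<union> F\<inverse>)"
      using F(1) by (auto simp: simple_graph_def U_def sym_def irrefl_def)
  next
    fix A B assume AB: "A \<subseteq> {..<n}" "B \<subseteq> {..<n}" "A \<inter> B = {}" "card A = k" "card B = k"
    then have "\<not> e (A, B) \<subseteq> F"
      using F(2) by (auto simp: I_def)
    \<comment> \<open>As \<open>F\<close> holds increasing pairs only, whichever orientation of an
      edge lies in \<open>F\<close> is the sorted one.\<close>
    moreover have "e (A, B) \<subseteq> F" if "A \<times> B \<subseteq> F \<union> F\<inverse>"
      using that F(1) by (fastforce simp: e_def U_def min_def max_def)
    ultimately show "\<not> A \<times> B \<subseteq> F \<union> F\<inverse>"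
      by blast
  next
    fix A B assume AB: "A \<subseteq> {..<n}" "B \<subseteq> {..<n}" "A \<inter> B = {}" "card A = t" "card B = t"
    then have "e (A, B) \<inter> F \<noteq> {}"
      using F(3) by (auto simp: I_def)
    then show "A \<times> B \<inter> (F \<union> F\<inverse>) \<noteq> {}"
      by (auto simp: e_def min_def max_def split: if_splits)
  qed
qed

section \<open>VC-dimension of graphs without a balanced biclique\<close>

text \<open>A shattered set of more than \<open>d\<close> vertices would yield a biclique:
  \<open>k \<le> d + 1\<close> leaves room for one side \<open>T\<close> inside it, and the
  exponential bound on \<open>k\<close> supplies enough common neighbours of \<open>T\<close> for
  the other side.\<close>

lemma vc_dim_le_of_no_biclique:
  assumes G: "simple_graph V E" and "k \<le> d + 1" "k \<le> 2 ^ (d + 1 - k)"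
    and no: "\<And>A B. A \<subseteq> V \<Longrightarrow> B \<subseteq> V \<Longrightarrow> A \<inter> B = {} \<Longrightarrow> card A = k \<Longrightarrow> card B = k
      \<Longrightarrow> \<not> A \<times> B \<subseteq> E"
    and "V \<noteq> {}"
  shows "vc_dim V E \<le> d"
proof -
  have fin: "finite V" and "sym E" "irrefl E"
    using G by (auto simp: simple_graph_def)
  have "card S \<le> d" if S: "shattered V E S" for S
  proof (rule ccontr)
    assume "\<not> card S \<le> d"
    then have dS: "d + 1 \<le> card S" by simp
    then obtain T where T: "T \<subseteq> S" "card T = k" "finite T"
      using obtain_subset_with_card_n \<open>k \<le> d + 1\<close> le_trans by metis
    have "S \<subseteq> V" using S by (simp add: shattered_def)
    with fin have "finite S" by (rule rev_finite_subset)
    define N where "N = {v \<in> V. T \<subseteq> neighbors E v}"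
    \<comment> \<open>Every set between \<open>T\<close> and \<open>S\<close> is the trace of some
      vertex, and that vertex is adjacent to all of \<open>T\<close>.\<close>
    have "(\<union>) T ` Pow (S - T) \<subseteq> (\<lambda>v. neighbors E v \<inter> S) ` N"
    proof
      fix B assume "B \<in> (\<union>) T ` Pow (S - T)"
      then have "T \<subseteq> B" "B \<subseteq> S" using T by auto
      with S obtain v where "v \<in> V" "neighbors E v \<inter> S = B"
        unfolding shattered_def by meson
      with \<open>T \<subseteq> B\<close> show "B \<in> (\<lambda>v. neighbors E v \<inter> S) ` N"
        by (auto simp: N_def)
    qed
    then have "card ((\<union>) T ` Pow (S - T)) \<le> card N"
      using fin by (intro surj_card_le) (auto simp: N_def)
    moreover have "inj_on ((\<union>) T) (Pow (S - T))"
      by (auto simp: inj_on_def)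
    ultimately have "2 ^ (card S - k) \<le> card N"
      using T \<open>finite S\<close> by (simp add: card_image card_Pow card_Diff_subset)
    moreover have "(2 :: nat) ^ (d + 1 - k) \<le> 2 ^ (card S - k)"
      using dS by (intro power_increasing) auto
    ultimately have "k \<le> card N"
      using \<open>k \<le> 2 ^ (d + 1 - k)\<close> by linarith
    then obtain M where M: "M \<subseteq> N" "card M = k"
      using obtain_subset_with_card_n by metis
    \<comment> \<open>A common vertex would be its own neighbour.\<close>
    have "T \<inter> M = {}"
      using M \<open>irrefl E\<close> by (auto simp: N_def neighbors_def irrefl_def)
    moreover have "T \<times> M \<subseteq> E"
      using M \<open>sym E\<close> by (auto simp: N_def neighbors_def sym_def)
    ultimately show False
      using no[of T M] T M \<open>S \<subseteq> V\<close> unfolding N_def by blast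
  qed
  moreover have "finite {card S | S. shattered V E S}"
    by (rule finite_subset[of _ "card ` Pow V"]) (use fin in \<open>auto simp: shattered_def\<close>)
  \<comment> \<open>Makes the set under \<open>Max\<close> nonempty.\<close>
  moreover have "shattered V E {}"
    using \<open>V \<noteq> {}\<close> by (auto simp: shattered_def)
  ultimately show ?thesis
    unfolding vc_dim_def by (subst Max_le_iff) auto
qed

section \<open>Estimates for the two expectations\<close>

lemma card_biclique_bound:
  assumes "d > 0" "d < 2 * k"
  shows "(\<lambda>n. real n ^ (2 * k) * (real n powr (- 4 / real d)) ^ k\<^sup>2) \<longlonglongrightarrow> 0"
proof -
  \<comment> \<open>The total exponent of \<open>n\<close>; it equals
    \<open>2 * k * (1 - 2 * k / d)\<close>, hence is negative once \<open>2 * k\<close> exceeds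
    \<open>d\<close>.\<close>
  define c where "c = 2 * real k - 4 / real d * real k ^ 2"
  have "4 / real d * real k ^ 2 = 2 * real k * (2 * real k / real d)"
    by (simp add: power2_eq_square)
  moreover have "2 * real k / real d > 1" "real k > 0"
    using assms by auto
  ultimately have "c < 0"
    using mult_strict_left_mono[of 1 "2 * real k / real d" "2 * real k"] by (simp only: c_def) simp
  then have "(\<lambda>n. real n powr c) \<longlonglongrightarrow> 0"
    by (intro tendsto_neg_powr filterlim_real_sequentially)
  moreover have "eventually (\<lambda>n. real n powr c
      = real n ^ (2 * k) * (real n powr (- 4 / real d)) ^ k\<^sup>2) sequentially"
    using eventually_gt_at_top[of 0]
  proof eventually_elim
    case (elim n)
    have "real n ^ (2 * k) * (real n powr (- 4 / real d)) ^ k\<^sup>2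
        = real n powr (2 * real k) * real n powr (- 4 / real d * real k ^ 2)"
      using elim by (simp add: powr_powr powr_realpow[symmetric])
    also have "\<dots> = real n powr c"
      by (simp add: c_def flip: powr_add)
    finally show ?case by simp
  qed
  ultimately show ?thesis
    by (rule Lim_transform_eventually)
qed

text \<open>By \<open>1 - p \<le> exp (- p)\<close> the product is at most the exponential of
  \<open>t * (2 * ln n - p * t)\<close>. The constant 4 makes the bracket at most
  \<open>- 2 * ln n\<close>, which leaves \<open>1 / n ^ 2\<close>.\<close>

lemma card_empty_pair_bound:
  fixes n t :: nat and p :: real
  assumes "n \<ge> 2" "p \<le> 1" "t \<ge> 1" "4 * ln (real n) \<le> p * real t"
  shows "real n ^ (2 * t) * (1 - p) ^ t\<^sup>2 \<le> 1 / 4"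
proof -
  have "real n ^ (2 * t) * (1 - p) ^ t\<^sup>2 \<le> exp (ln (real n)) ^ (2 * t) * exp (- p) ^ t\<^sup>2"
    using assms exp_ge_add_one_self[of "- p"]
    by (intro mult_mono power_mono) auto
  also have "\<dots> = exp (real t * (2 * ln (real n) - p * real t))"
    by (simp add: exp_add[symmetric] exp_of_nat_mult[symmetric] algebra_simps power2_eq_square)
  also have "\<dots> \<le> exp (- 2 * ln (real n))"
  proof -
    have "real t * (2 * ln (real n) - p * real t) \<le> real t * (- 2 * ln (real n))"
      using assms by (intro mult_left_mono) auto
    also have "\<dots> \<le> 1 * (- 2 * ln (real n))"
      using assms by (intro mult_right_mono_neg) auto
    finally show ?thesis by simp
  qed
  also have "\<dots> = 1 / real n ^ 2"
    using assms by (simp add: exp_minus exp_of_nat_mult[of 2, simplified] inverse_eq_divide)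
  also have "\<dots> \<le> 1 / 2 ^ 2"
    using assms by (intro divide_left_mono power_mono) auto
  finally show ?thesis by simp
qed

section \<open>Choice of parameters\<close>

theorem theorem6:
  fixes d :: nat
  assumes "d \<ge> 5"
  shows "\<forall>\<^sub>F n in sequentially.
    \<exists>(V :: nat set) E. simple_graph V E \<and> card V = n \<and> vc_dim V E \<le> d \<and>
      \<not> (\<exists>A B. A \<subseteq> V \<and> B \<subseteq> V \<and> A \<inter> B = {} \<and>
            real (card A) \<ge> 4 * real n powr (4 / real d) * ln (real n) \<and>
            real (card B) \<ge> 4 * real n powr (4 / real d) * ln (real n) \<and>
            homogeneous E A B)"
proof -
  \<comment> \<open>The least integer above \<open>d / 2\<close>: large enough for bicliques to be
    rare, small enough for the VC-dimension argument.\<close>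
  define k where "k = d div 2 + 1"
  have k: "d < 2 * k" "k \<le> d + 1"
    by (auto simp: k_def)
  have "k - 1 < 2 ^ (k - 1)"
    by (rule less_exp)
  also have "(2 :: nat) ^ (k - 1) \<le> 2 ^ (d + 1 - k)"
    by (intro power_increasing) (auto simp: k_def)
  finally have k2: "k \<le> 2 ^ (d + 1 - k)"
    by simp
  have "\<forall>\<^sub>F n in sequentially. real n ^ (2 * k) * (real n powr (- 4 / real d)) ^ k\<^sup>2 < 1 / 2"
    by (rule order_tendstoD[OF card_biclique_bound]) (use assms k in auto)
  \<comment> \<open>Ensures \<open>k \<le> t\<close> below, so that a large complete pair contains a
    biclique with sides of size \<open>k\<close>.\<close>
  moreover have "\<forall>\<^sub>F n in sequentially. ln (real n) \<ge> real k / 4"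
    using filterlim_compose[OF ln_at_top filterlim_real_sequentially]
    by (simp only: filterlim_at_top o_def)
  ultimately show ?thesis
    using eventually_ge_at_top[of 2]
  proof eventually_elim
    case (elim n)
    define p where "p = real n powr (- 4 / real d)"
    define s where "s = 4 * real n powr (4 / real d) * ln (real n)"
    \<comment> \<open>Rounding up keeps \<open>p * t\<close> at least \<open>4 * ln n\<close>, and a
      cardinality that is at least \<open>s\<close> is still at least \<open>t\<close>.\<close>
    define t where "t = nat \<lceil>s\<rceil>"
    have p: "0 \<le> p" "p \<le> 1"
      using elim powr_mono[of "- 4 / real d" 0 "real n"] by (auto simp: p_def)
    have "real n powr (4 / real d) \<ge> 1"
      using elim by (intro ge_one_powr_ge_zero) auto
    then have "s \<ge> 4 * ln (real n)"
      using elim by (simp add: s_def mult_le_cancel_right1)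
    with elim have "real k \<le> s" by linarith
    have "s \<le> real t"
      by (simp add: t_def real_nat_ceiling_ge)
    with \<open>real k \<le> s\<close> have "k \<le> t" by linarith
    \<comment> \<open>The powers of \<open>n\<close> in \<open>p\<close> and \<open>s\<close>
      cancel.\<close>
    have "4 * ln (real n) = p * s"
      using elim by (simp add: p_def s_def powr_minus)
    also have "\<dots> \<le> p * real t"
      using p \<open>s \<le> real t\<close> by (intro mult_left_mono)
    finally have "real n ^ (2 * t) * (1 - p) ^ t\<^sup>2 \<le> 1 / 4"
      using elim p \<open>k \<le> t\<close> by (intro card_empty_pair_bound) (auto simp: k_def)
    with elim have "real n ^ (2 * k) * p ^ k\<^sup>2 + real n ^ (2 * t) * (1 - p) ^ t\<^sup>2 < 1"
      by (simp add: p_def)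
    from ex_graph_without_biclique_or_empty_pair[OF p this]
    obtain E where G: "simple_graph {..<n} E"
      and no_biclique: "\<And>A B. A \<subseteq> {..<n} \<Longrightarrow> B \<subseteq> {..<n} \<Longrightarrow> A \<inter> B = {} \<Longrightarrow> card A = k
        \<Longrightarrow> card B = k \<Longrightarrow> \<not> A \<times> B \<subseteq> E"
      and no_empty_pair: "\<And>A B. A \<subseteq> {..<n} \<Longrightarrow> B \<subseteq> {..<n} \<Longrightarrow> A \<inter> B = {} \<Longrightarrow> card A = t
        \<Longrightarrow> card B = t \<Longrightarrow> A \<times> B \<inter> E \<noteq> {}"
      by blast
    have "vc_dim {..<n} E \<le> d"
      using G k k2 no_biclique elim
      by (intro vc_dim_le_of_no_biclique[of _ _ k]) (auto simp: lessThan_empty_iff)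
    moreover have "\<not> homogeneous E A B"
      if AB: "A \<subseteq> {..<n}" "B \<subseteq> {..<n}" "A \<inter> B = {}" "s \<le> card A" "s \<le> card B" for A B
    proof
      have "t \<le> card A" "t \<le> card B"
        using AB by (auto simp: t_def ceiling_le_iff nat_le_iff)
      \<comment> \<open>Homogeneity passes to subsets, so both sides can be cut down to the exact
        sizes that \<open>E\<close> excludes.\<close>
      have restrict: "\<exists>A' B'. A' \<subseteq> A \<and> B' \<subseteq> B \<and> card A' = m \<and> card B' = m" if "m \<le> t" for m
        using that \<open>t \<le> card A\<close> \<open>t \<le> card B\<close> obtain_subset_with_card_n[of m A]
          obtain_subset_with_card_n[of m B] by (metis le_trans)
      assume "homogeneous E A B"
      then consider "A \<times> B \<subseteq> E" | "A \<times> B \<inter> E = {}"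
        by (auto simp: homogeneous_def)
      then show False
      proof cases
        case 1
        from restrict[OF \<open>k \<le> t\<close>] obtain A' B'
          where *: "A' \<subseteq> A" "B' \<subseteq> B" "card A' = k" "card B' = k" by blast
        with AB have "\<not> A' \<times> B' \<subseteq> E"
          by (intro no_biclique) auto
        with 1 * show False by blast
      next
        case 2
        from restrict[OF order_refl] obtain A' B'
          where *: "A' \<subseteq> A" "B' \<subseteq> B" "card A' = t" "card B' = t" by blast
        with AB have "A' \<times> B' \<inter> E \<noteq> {}"
          by (intro no_empty_pair) auto
        with 2 * show False by blast
      qed
    qed
    ultimately show ?case
      using G unfolding s_def by (intro exI[of _ "{..<n}"] exI[of _ E]) auto
  qed
qed

end
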